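(* Let $\Omega\subset X$ be open and connected and let $\mu$ be a doubling measure on $X$. Let $f:\Omega\to\mathbb{R}$ be strongly harmonic and continuous in $\Omega$. If $f$ attains its maximum in $\Omega$, then $f$ is constant. The same assertion holds if $f$ is weakly harmonic in $\Omega$ and continuous in $\Omega$.
   Context: Standing assumptions: $(X,d,\mu)$ is a metric measure space, $\mu$ is Borel regular, $0<\mu(B)<\infty$ for every ball $B$, and $X$ is proper. $B(x,r)$ is the open ball; $A\Subset\Omega$ means that the closure of $A$ is a compact subset of $\Omega$. $\mu$ is doubling if there is $C_\mu>0$ with $\mu(B(x,2r))\le C_\mu\mu(B(x,r))$ for all balls. A locally integrable $f:\Omega\to\mathbb{R}$ is strongly harmonic in $\Omega$ if $f(x)=\frac{1}{\mu(B(x,r))}\int_{B(x,r)}f\,d\mu$ for all $x\in\Omega$, $r>0$ with $B(x,r)\Subset\Omega$. It is weakly harmonic if for every $x\in\Omega$ there is a non-empty, at most countable set of positive radii $r^x_i$ (admissible radii at $x$) with $B(x,r^x_i)\Subset\Omega$ and $f(x)=\frac{1}{\mu(B(x,r^x_i))}\int_{B(x,r^x_i)}f\,d\mu$ for all $i$. *)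

theory Defs
  imports "HOL-Analysis.Analysis"
begin

definition proper_space :: "'a::metric_space itself \<Rightarrow> bool"
  where "proper_space _ \<longleftrightarrow> (\<forall>S::'a set. closed S \<and> bounded S \<longrightarrow> compact S)"

text \<open>The measurable sets may be strictly larger than the Borel sets (for instance the
  Caratheodory-measurable sets of a Borel regular outer measure), so that Borel regularity is
  a genuine condition. The inclusion forces \<^term>\<open>space \<mu> = UNIV\<close>.\<close>

definition borel_regular :: "'a::topological_space measure \<Rightarrow> bool"
  where "borel_regular \<mu> \<longleftrightarrow> sets borel \<subseteq> sets \<mu> \<and>
    (\<forall>A\<in>sets \<mu>. \<exists>B\<in>sets borel. A \<subseteq> B \<and> emeasure \<mu> B = emeasure \<mu> A)"

definition metric_measure_space :: "'a::metric_space measure \<Rightarrow> bool"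
  where "metric_measure_space \<mu> \<longleftrightarrow> borel_regular \<mu> \<and>
    (\<forall>x r. 0 < r \<longrightarrow> 0 < emeasure \<mu> (ball x r) \<and> emeasure \<mu> (ball x r) < \<infinity>)"

definition doubling_measure :: "'a::metric_space measure \<Rightarrow> bool"
  where "doubling_measure \<mu> \<longleftrightarrow>
    (\<exists>C>0. \<forall>x r. 0 < r \<longrightarrow> emeasure \<mu> (ball x (2 * r)) \<le> ennreal C * emeasure \<mu> (ball x r))"

definition compactly_contained :: "'a::topological_space set \<Rightarrow> 'a set \<Rightarrow> bool"
  where "compactly_contained A \<Omega> \<longleftrightarrow> compact (closure A) \<and> closure A \<subseteq> \<Omega>"

text \<open>A function on \<^term>\<open>\<Omega>\<close> is represented by a total function; local integrability and harmonicity depend only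
  on its values on \<^term>\<open>\<Omega>\<close>.\<close>

definition locally_integrable_on ::
    "'a::metric_space measure \<Rightarrow> ('a \<Rightarrow> real) \<Rightarrow> 'a set \<Rightarrow> bool"
  where "locally_integrable_on \<mu> f \<Omega> \<longleftrightarrow>
    (\<forall>x\<in>\<Omega>. \<exists>r>0. ball x r \<subseteq> \<Omega> \<and> set_integrable \<mu> (ball x r) f)"

definition ball_average :: "'a::metric_space measure \<Rightarrow> ('a \<Rightarrow> real) \<Rightarrow> 'a \<Rightarrow> real \<Rightarrow> real"
  where "ball_average \<mu> f x r = 1 / measure \<mu> (ball x r) * (LINT y:ball x r|\<mu>. f y)"

definition strongly_harmonic_on ::
    "'a::metric_space measure \<Rightarrow> ('a \<Rightarrow> real) \<Rightarrow> 'a set \<Rightarrow> bool"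
  where "strongly_harmonic_on \<mu> f \<Omega> \<longleftrightarrow> locally_integrable_on \<mu> f \<Omega> \<and>
    (\<forall>x\<in>\<Omega>. \<forall>r>0. compactly_contained (ball x r) \<Omega> \<longrightarrow> f x = ball_average \<mu> f x r)"

definition weakly_harmonic_on ::
    "'a::metric_space measure \<Rightarrow> ('a \<Rightarrow> real) \<Rightarrow> 'a set \<Rightarrow> bool"
  where "weakly_harmonic_on \<mu> f \<Omega> \<longleftrightarrow> locally_integrable_on \<mu> f \<Omega> \<and>
    (\<forall>x\<in>\<Omega>. \<exists>R. R \<noteq> {} \<and> countable R \<and>
      (\<forall>r\<in>R. 0 < r \<and> compactly_contained (ball x r) \<Omega> \<and> f x = ball_average \<mu> f x r))"

end

theory Submission
  imports Defs
begin

text \<open>Let \<open>M\<close> be the maximum of \<open>f\<close>. If \<open>f x = M\<close> equals the average of \<open>f\<close> over a ball around \<open>x\<close>,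
  then the non-negative function \<open>M - f\<close> has integral zero over that ball. As non-empty open sets
  have positive measure, continuity forces \<open>f = M\<close> on the whole ball. So the set where \<open>f = M\<close> is
  open; it is also relatively closed, hence all of \<open>\<Omega>\<close> by connectedness. One radius per point is
  enough, and strong harmonicity provides it since closed balls are compact.\<close>

text \<open>\<open>sets \<mu>\<close> may be strictly larger than the Borel sets, so Borel
  measurability has to be transferred. The inclusion puts \<open>UNIV\<close> into
  \<open>sets \<mu>\<close>, which makes the two underlying spaces agree.\<close>

lemma measurable_if_sets_borel_subset:
  assumes "sets borel \<subseteq> sets \<mu>" and "g \<in> borel_measurable borel"
  shows "g \<in> borel_measurable \<mu>"
proof -
  have "space \<mu> = UNIV"
    using subsetD[OF assms(1) borel_open[OF open_UNIV]] sets.sets_into_space by blast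
  then show ?thesis
    using assms measurable_sets[OF assms(2)] by (auto simp: measurable_def)
qed

text \<open>By continuity \<open>f\<close> is bounded on the compact closure of the ball, and the
  ball has finite measure.\<close>

lemma set_integrable_compactly_contained_ball:
  fixes f :: "'a::metric_space \<Rightarrow> real"
  assumes \<mu>: "metric_measure_space \<mu>" and cont: "continuous_on \<Omega> f"
    and r: "0 < r" and cc: "compactly_contained (ball x r) \<Omega>"
  shows "set_integrable \<mu> (ball x r) f"
proof -
  have sub: "sets borel \<subseteq> sets \<mu>" and fin: "emeasure \<mu> (ball x r) < \<infinity>"
    using \<mu> r by (auto simp: metric_measure_space_def borel_regular_def)
  have cl: "compact (closure (ball x r))" "closure (ball x r) \<subseteq> \<Omega>"
    using cc by (auto simp: compactly_contained_def)
  have "bounded (f ` closure (ball x r))"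
    using cl cont continuous_on_subset compact_continuous_image compact_imp_bounded by metis
  then obtain K where K: "\<And>y. y \<in> closure (ball x r) \<Longrightarrow> norm (f y) \<le> K"
    unfolding bounded_iff by auto
  have "ball x r \<subseteq> \<Omega>"
    using cl(2) closure_subset by blast
  \<comment> \<open>Nothing is known about \<open>f\<close> outside \<open>\<Omega>\<close>; only
    its cutoff to the ball is Borel on the whole space.\<close>
  then have "(\<lambda>y. indicator (ball x r) y *\<^sub>R f y) \<in> borel_measurable borel"
    using cont by (intro borel_measurable_continuous_on_indicator) (auto intro: continuous_on_subset)
  then have "(\<lambda>y. indicator (ball x r) y *\<^sub>R f y) \<in> borel_measurable \<mu>"
    by (rule measurable_if_sets_borel_subset[OF sub])
  then show ?thesis
    unfolding set_integrable_def
    using sub fin K closure_subset[of "ball x r"]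
    by (intro integrableI_bounded_set[where A = "ball x r" and B = K] AE_I2)
      (auto simp: indicator_def)
qed

lemma constant_on_ball_if_ball_average_eq_max:
  fixes f :: "'a::metric_space \<Rightarrow> real"
  assumes \<mu>: "metric_measure_space \<mu>" and cont: "continuous_on \<Omega> f"
    and max: "\<And>y. y \<in> \<Omega> \<Longrightarrow> f y \<le> f x"
    and r: "0 < r" and cc: "compactly_contained (ball x r) \<Omega>"
    and avg: "f x = ball_average \<mu> f x r"
    and z: "z \<in> ball x r"
  shows "f z = f x"
proof (rule ccontr)
  assume ne: "f z \<noteq> f x"
  let ?B = "ball x r"
  have sub: "sets borel \<subseteq> sets \<mu>"
    and fin: "emeasure \<mu> ?B < \<infinity>" and pos: "0 < emeasure \<mu> ?B"
    using \<mu> r by (auto simp: metric_measure_space_def borel_regular_def)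
  have B: "?B \<in> sets \<mu>"
    using sub by auto
  have B\<Omega>: "?B \<subseteq> \<Omega>"
    using cc closure_subset by (auto simp: compactly_contained_def)
  have mpos: "0 < measure \<mu> ?B"
    using fin pos by (simp add: measure_def enn2real_positive_iff)
  have int: "set_integrable \<mu> ?B f"
    by (rule set_integrable_compactly_contained_ball[OF \<mu> cont r cc])
  have intc: "set_integrable \<mu> ?B (\<lambda>_. f x)"
    using B fin by (simp add: set_integrable_def)
  have "(LINT y:?B|\<mu>. f x - f y) = (LINT y:?B|\<mu>. f x) - (LINT y:?B|\<mu>. f y)"
    by (rule set_integral_diff[OF intc int])
  also have "(LINT y:?B|\<mu>. f x) = measure \<mu> ?B * f x"
    using B fin by (simp add: set_lebesgue_integral_def)
  \<comment> \<open>The positive measure of the ball allows the quotient in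
    \<open>ball_average\<close> to be cleared.\<close>
  also have "(LINT y:?B|\<mu>. f y) = measure \<mu> ?B * f x"
    using avg mpos by (simp add: ball_average_def)
  finally have zero: "(LINT y:?B|\<mu>. f x - f y) = 0"
    by simp
  have "AE y in \<mu>. indicator ?B y *\<^sub>R (f x - f y) = 0"
  proof (subst integral_nonneg_eq_0_iff_AE[symmetric])
    show "integrable \<mu> (\<lambda>y. indicator ?B y *\<^sub>R (f x - f y))"
      using set_integral_diff(1)[OF intc int] by (simp add: set_integrable_def)
    show "AE y in \<mu>. 0 \<le> indicator ?B y *\<^sub>R (f x - f y)"
      \<comment> \<open>Maximality gives the sign on the ball; elsewhere the indicator makes the
        integrand zero.\<close>
      using max B\<Omega> by (intro AE_I2) (auto simp: indicator_def)
    show "(LINT y|\<mu>. indicator ?B y *\<^sub>R (f x - f y)) = 0"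
      using zero by (simp add: set_lebesgue_integral_def)
  qed
  then have AE: "AE y in \<mu>. y \<notin> {y \<in> ?B. f y \<noteq> f x}"
    by eventually_elim (auto simp: indicator_def)
  \<comment> \<open>This is the preimage of the open set \<open>- {f x}\<close> under
    \<open>f\<close> restricted to an open ball, so it is open in the whole space. It contains
    \<open>z\<close>, hence a ball around \<open>z\<close>, which would have to be null.\<close>
  have "open {y \<in> ?B. f y \<noteq> f x}"
    using continuous_open_preimage[OF continuous_on_subset[OF cont B\<Omega>] open_ball, of "- {f x}"]
    by (auto simp: vimage_def Int_def open_Compl)
  then obtain e where e: "0 < e" "ball z e \<subseteq> {y \<in> ?B. f y \<noteq> f x}"
    using z ne by (metis (mono_tags, lifting) mem_Collect_eq open_contains_ball)
  from AE have "AE y in \<mu>. y \<notin> ball z e"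
    by eventually_elim (use e in auto)
  moreover have "ball z e \<in> sets \<mu>"
    using sub by auto
  ultimately have "emeasure \<mu> (ball z e) = 0"
    using AE_iff_null_sets null_setsD1 by blast
  moreover have "0 < emeasure \<mu> (ball z e)"
    using \<mu> e(1) by (simp add: metric_measure_space_def)
  ultimately show False
    by simp
qed

lemma constant_on_if_ball_average_somewhere:
  fixes f :: "'a::metric_space \<Rightarrow> real"
  assumes \<mu>: "metric_measure_space \<mu>" and conn: "connected \<Omega>" and cont: "continuous_on \<Omega> f"
    and max: "\<exists>x\<in>\<Omega>. \<forall>y\<in>\<Omega>. f y \<le> f x"
    and mean: "\<And>x. x \<in> \<Omega> \<Longrightarrow>
      \<exists>r>0. compactly_contained (ball x r) \<Omega> \<and> f x = ball_average \<mu> f x r"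
  shows "f constant_on \<Omega>"
proof -
  obtain a where a: "a \<in> \<Omega>" "\<And>y. y \<in> \<Omega> \<Longrightarrow> f y \<le> f a"
    using max by blast
  let ?S = "{x \<in> \<Omega>. f x = f a}"
  have "open ?S"
    unfolding open_contains_ball
  proof
    fix x assume x: "x \<in> ?S"
    then obtain r where r: "0 < r" "compactly_contained (ball x r) \<Omega>" "f x = ball_average \<mu> f x r"
      using mean by blast
    \<comment> \<open>Each point of \<open>?S\<close> is itself a maximum point, so the ball lemma
      applies at \<open>x\<close> and not only at \<open>a\<close>.\<close>
    have "\<And>y. y \<in> \<Omega> \<Longrightarrow> f y \<le> f x"
      using x a by auto
    then have "\<forall>z\<in>ball x r. f z = f x"
      using constant_on_ball_if_ball_average_eq_max[OF \<mu> cont _ r] by blast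
    moreover have "ball x r \<subseteq> \<Omega>"
      using r(2) closure_subset by (auto simp: compactly_contained_def)
    ultimately have "ball x r \<subseteq> ?S"
      using x by fastforce
    then show "\<exists>e>0. ball x e \<subseteq> ?S"
      using r(1) by blast
  qed
  then have "openin (top_of_set \<Omega>) ?S"
    by (intro open_subset) auto
  moreover have "closedin (top_of_set \<Omega>) ?S"
    by (rule continuous_closedin_preimage_constant[OF cont])
  ultimately have "?S = \<Omega>"
    using conn[unfolded connected_clopen, rule_format, of ?S] a(1) by auto
  then show ?thesis
    unfolding constant_on_def by blast
qed

lemma ex_compactly_contained_ball:
  fixes x :: "'a::metric_space"
  assumes proper: "proper_space TYPE('a)" and "open \<Omega>" and "x \<in> \<Omega>"
  shows "\<exists>r>0. compactly_contained (ball x r) \<Omega>"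
proof -
  obtain e where e: "0 < e" "cball x e \<subseteq> \<Omega>"
    using assms by (auto simp: open_contains_cball)
  \<comment> \<open>In a metric space the closure of an open ball can be smaller than the closed
    ball; the inclusion suffices.\<close>
  have "closure (ball x e) \<subseteq> cball x e"
    by (simp add: closure_minimal)
  moreover have "compact (closure (ball x e))"
    using proper unfolding proper_space_def by (metis bounded_ball bounded_closure closed_closure)
  ultimately show ?thesis
    using e by (auto simp: compactly_contained_def)
qed

theorem proposition4p2:
  fixes \<mu> :: "'a::metric_space measure"
    and \<Omega> :: "'a set"
    and f :: "'a \<Rightarrow> real"
  assumes "proper_space TYPE('a)"
    and "metric_measure_space \<mu>"
    and "doubling_measure \<mu>"
    and "open \<Omega>"
    and "connected \<Omega>"
    and "continuous_on \<Omega> f"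
    and "\<exists>x\<in>\<Omega>. \<forall>y\<in>\<Omega>. f y \<le> f x"
  shows "(strongly_harmonic_on \<mu> f \<Omega> \<longrightarrow> f constant_on \<Omega>) \<and>
         (weakly_harmonic_on \<mu> f \<Omega> \<longrightarrow> f constant_on \<Omega>)"
proof (intro conjI impI)
  note const = constant_on_if_ball_average_somewhere[OF assms(2,5,6,7)]
  show "f constant_on \<Omega>" if "strongly_harmonic_on \<mu> f \<Omega>"
    using that ex_compactly_contained_ball[OF assms(1,4)]
    by (intro const) (metis strongly_harmonic_on_def)
  show "f constant_on \<Omega>" if "weakly_harmonic_on \<mu> f \<Omega>"
    \<comment> \<open>Any element of the non-empty set of admissible radii serves as the
      radius.\<close>
    using that by (intro const) (metis weakly_harmonic_on_def ex_in_conv)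
qed

end
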